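(* Let $W=(w_1,\ldots,w_{k-1})$ be a legal schedule, let $BD$ be a bar diagram of $W$, and let $S\subseteq X_k$ be the set of $x_i$ whose bars are up in $BD$. For $1\le i\le k-1$ let $a_i$ denote the number of elements of $\{x_{i-1},x_{i-2},\ldots,x_{i-w_i}\}$ that are in $S$. Then the coefficient $A_S(q)$ of $\prod_{x_i\in S}x_i$ in $P_W(X_k;q)$ is $$A_S(q)=q^{\chi(x_{-1}\in S)}\prod_{\substack{1\le i\le k-1\\ x_i\in S}}[a_i]_q\ \prod_{\substack{1\le i\le k-1\\ x_i\notin S}}q^{a_i}[w_i-a_i]_q .$$
   Context: For an integer $m\ge 0$, $[m]_q=1+q+\cdots+q^{m-1}$ ($[0]_q=0$); $\chi(\cdot)$ is $1$ if the statement is true and $0$ otherwise. A legal schedule is a (possibly empty) finite sequence of integers $W=(w_1,\ldots,w_{k-1})$, $k\ge 1$, with $1\le w_1\le 2$ and $1\le w_i\le w_{i-1}+1$ for $2\le i\le k-1$. Its alphabet is $X_k=\{x_{-1},x_0,x_1,\ldots,x_{k-1}\}$. Polynomials $P_W(X_k;q)$ are defined recursively: for the empty schedule ($k=1$), $P_{\emptyset}=q\,x_{-1}+x_0$; and for a legal schedule $W=(w_1,\ldots,w_{k-1})$ and an integer $w$ with $1\le w\le w_{k-1}+1$ (for $k=1$: $1\le w\le 2$), letting $W,w$ denote the schedule obtained by appending $w$ to $W$, $$P_{W,w}(X_{k+1};q)=\frac{x_k-q^w}{1-q}P_W(X_k;q)+\frac{1-x_k}{1-q}\Big(P_W(X_k;q)\Big|_{x_{k-i}\to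 q x_{k-i},\ 1\le i\le w}\Big).$$ A bar diagram of $W$ is an assignment of "up" or "down" to each of the bars $x_{-1},x_0,\ldots,x_{k-1}$ such that exactly one of $x_{-1},x_0$ is up and, for every $1\le i\le k-1$, at least one of the bars $x_{i-1},\ldots,x_{i-w_i}$ is in the same state (up or down) as bar $x_i$. *)

theory Defs
  imports
    "HOL-Library.Poly_Mapping"
    "HOL-Computational_Algebra.Polynomial"
    "HOL-Computational_Algebra.Fraction_Field"
begin

text \<open>
  The recursion for the schedule polynomials divides by \<open>1 - q\<close>, so coefficients are taken
  in the field \<open>\<rat>(q)\<close> of fractions of \<open>\<int>[q]\<close>, with \<open>q\<close> an indeterminate.  The variables
  \<open>x\<^bsub>-1\<^esub>, x\<^bsub>0\<^esub>, x\<^bsub>1\<^esub>, \<dots>\<close> are indexed by integers; a monomial is its exponent map.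
\<close>

type_synonym qrat = "int poly fract"
type_synonym xmonom = "int \<Rightarrow>\<^sub>0 nat"
type_synonym xpoly = "xmonom \<Rightarrow>\<^sub>0 qrat"

definition q :: qrat where
  "q = Fract [:0, 1:] 1"

definition qint :: "nat \<Rightarrow> qrat" where
  "qint m = (\<Sum>j<m. q ^ j)"

definition Const :: "qrat \<Rightarrow> xpoly" where
  "Const c = Poly_Mapping.single 0 c"

definition Var :: "int \<Rightarrow> xpoly" where
  "Var i = Poly_Mapping.single (Poly_Mapping.single i 1) 1"

definition subst_vars :: "(int \<Rightarrow> xpoly) \<Rightarrow> xpoly \<Rightarrow> xpoly" where
  "subst_vars \<sigma> p =
    (\<Sum>m\<in>Poly_Mapping.keys p.
      Const (Poly_Mapping.lookup p m) *
      (\<Prod>i\<in>Poly_Mapping.keys m. \<sigma> i ^ Poly_Mapping.lookup m i))"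

text \<open>
  A schedule \<open>(w\<^sub>1, \<dots>, w\<^bsub>k-1\<^esub>)\<close> is a list of length \<open>k - 1\<close>; since its entries are required to
  be positive, natural numbers are used.  List positions start at \<open>0\<close>, hence the shift.
\<close>

definition size_k :: "nat list \<Rightarrow> nat" where
  "size_k W = length W + 1"

definition entry :: "nat list \<Rightarrow> nat \<Rightarrow> nat" where
  "entry W i = W ! (i - 1)"

definition legal_schedule :: "nat list \<Rightarrow> bool" where
  "legal_schedule W \<longleftrightarrow>
    (1 \<le> size_k W - 1 \<longrightarrow> 1 \<le> entry W 1 \<and> entry W 1 \<le> 2) \<and>
    (\<forall>i\<in>{2..size_k W - 1}. 1 \<le> entry W i \<and> entry W i \<le> entry W (i - 1) + 1)"

definition alphabet :: "nat list \<Rightarrow> int set" where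
  "alphabet W = {-1..int (size_k W) - 1}"

text \<open>
  The new variable, for \<open>W\<close> with \<open>k = size_k W\<close>, is \<open>x\<^sub>k\<close>; the substitution scales
  \<open>x\<^bsub>k-w\<^esub>, \<dots>, x\<^bsub>k-1\<^esub>\<close> by \<open>q\<close>.  The recursion also assigns values to lists that
  are not legal schedules; these are not meaningful.
\<close>

function sched_poly :: "nat list \<Rightarrow> xpoly" where
  "sched_poly [] = Const q * Var (-1) + Var 0"
| "sched_poly (W @ [w]) =
    (let k = int (size_k W) in
      Const (1 / (1 - q)) * (Var k - Const (q ^ w)) * sched_poly W +
      Const (1 / (1 - q)) * (1 - Var k) *
        subst_vars (\<lambda>j. if j \<in> {k - int i | i. 1 \<le> i \<and> i \<le> w} then Const q * Var j else Var j)
          (sched_poly W))"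
  using rev_exhaust by (atomize_elim, blast) auto
termination
  by (relation "measure length") auto

datatype bar_state = Up | Down

text \<open>
  Only the states of the bars with index in \<^term>\<open>alphabet W\<close> matter: for a legal
  schedule \<open>i - w\<^sub>i \<ge> -1\<close>, so no other bar is inspected.
\<close>

definition bar_diagram :: "nat list \<Rightarrow> (int \<Rightarrow> bar_state) \<Rightarrow> bool" where
  "bar_diagram W BD \<longleftrightarrow>
    ((BD (-1) = Up) \<noteq> (BD 0 = Up)) \<and>
    (\<forall>i\<in>{1..size_k W - 1}. \<exists>j\<in>{1..entry W i}. BD (int i - int j) = BD (int i))"

definition up_set :: "nat list \<Rightarrow> (int \<Rightarrow> bar_state) \<Rightarrow> int set" where
  "up_set W BD = {i \<in> alphabet W. BD i = Up}"

definition sqfree_monom :: "int set \<Rightarrow> xmonom" where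
  "sqfree_monom S = (\<Sum>i\<in>S. Poly_Mapping.single i 1)"

end

theory Submission imports Defs begin

text \<open>
  Substituting \<open>q x\<^sub>j\<close> for \<open>x\<^sub>j\<close> at every \<open>j\<close> in a set \<open>D\<close> acts diagonally on
  monomials: it multiplies the coefficient of a monomial \<open>m\<close> by \<open>q\<^sup>d\<close>, where \<open>d\<close> is the degree
  of \<open>m\<close> in the variables indexed by \<open>D\<close>.  The recursion that appends an entry \<open>w\<close> is affine in
  the new variable \<open>x\<^sub>k\<close>, so comparing coefficients shows that a monomial \<open>m\<close> without \<open>x\<^sub>k\<close>
  and with old coefficient \<open>c\<close> contributes

  \<^item> to \<open>m x\<^sub>k\<close> the coefficient \<open>c (1 - q\<^sup>d) / (1 - q) = c [d]\<^sub>q\<close>, and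

  \<^item> to \<open>m\<close> the coefficient \<open>c (q\<^sup>d - q\<^sup>w) / (1 - q) = c q\<^sup>d [w - d]\<^sub>q\<close>.

  For the square-free monomial of a set \<open>S\<close>, the degree \<open>d\<close> is the number of elements of \<open>S\<close>
  among the \<open>w\<close> indices preceding \<open>k\<close>, that is, \<open>a\<^sub>k\<close>.  Induction on the schedule therefore
  collects exactly one factor of the product formula for each \<open>x\<^sub>i\<close>, starting from the
  coefficients \<open>q\<close> of \<open>x\<^bsub>-1\<^esub>\<close> and \<open>1\<close> of \<open>x\<^sub>0\<close>.  The two coefficient rules are
  \<open>lookup_sched_poly_snoc_up\<close> and \<open>lookup_sched_poly_snoc_down\<close>.

  The state condition on a bar \<open>i \<ge> 1\<close> says precisely that its factor is nonzero: the factor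
  of an up bar vanishes when \<open>a\<^sub>i = 0\<close>, that of a down bar when \<open>a\<^sub>i = w\<^sub>i\<close>.  The induction runs
  over sets \<open>S\<close> containing exactly one of \<open>-1\<close> and \<open>0\<close>, a property that survives the removal
  of the last index.
\<close>

section \<open>Coefficients of products\<close>

lemma lookup_single_mult_shift:
  fixes p :: "'a::cancel_comm_monoid_add \<Rightarrow>\<^sub>0 'b::comm_semiring_1"
  shows "Poly_Mapping.lookup (Poly_Mapping.single t c * p) (t + m) = c * Poly_Mapping.lookup p m"
  by (simp add: lookup_mult lookup_single when_mult)

lemma lookup_single_mult_eq_0:
  fixes p :: "'a::comm_monoid_add \<Rightarrow>\<^sub>0 'b::comm_semiring_1"
  assumes "\<And>l. s \<noteq> t + l"
  shows "Poly_Mapping.lookup (Poly_Mapping.single t c * p) s = 0"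
  using assms by (simp add: lookup_mult lookup_single when_mult)

lemma lookup_Const_mult [simp]:
  "Poly_Mapping.lookup (Const c * p) m = c * Poly_Mapping.lookup p m"
  using lookup_single_mult_shift[of 0 c p m] by (simp add: Const_def)

lemma lookup_Var_mult_shift [simp]:
  "Poly_Mapping.lookup (Var k * p) (Poly_Mapping.single k 1 + m) = Poly_Mapping.lookup p m"
  using lookup_single_mult_shift[of "Poly_Mapping.single k 1" 1 p m] by (simp add: Var_def)

lemma lookup_Var_mult_eq_0:
  assumes "Poly_Mapping.lookup m k = 0"
  shows "Poly_Mapping.lookup (Var k * p) m = 0"
  unfolding Var_def
proof (rule lookup_single_mult_eq_0)
  fix l show "m \<noteq> Poly_Mapping.single k 1 + l"
    using assms by (auto simp: lookup_add)
qed

section \<open>Scaling a set of variables\<close>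

definition degree_in :: "int set \<Rightarrow> xmonom \<Rightarrow> nat" where
  "degree_in D m = (\<Sum>i\<in>Poly_Mapping.keys m \<inter> D. Poly_Mapping.lookup m i)"

definition scale_vars :: "int set \<Rightarrow> xpoly \<Rightarrow> xpoly" where
  "scale_vars D = subst_vars (\<lambda>j. if j \<in> D then Const q * Var j else Var j)"

lemma Const_one: "Const 1 = 1"
  by (simp add: Const_def)

lemma Const_power: "Const c ^ n = Const (c ^ n)"
  by (induction n) (auto simp: Const_def mult_single)

lemma Const_prod: "(\<Prod>i\<in>I. Const (f i)) = Const (\<Prod>i\<in>I. f i)"
  by (induction I rule: infinite_finite_induct) (auto simp: Const_def mult_single)

lemma Var_power: "Var i ^ n = Poly_Mapping.single (Poly_Mapping.single i n) 1"
  by (induction n) (auto simp: Var_def mult_single single_add[symmetric])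

lemma prod_single_one:
  "(\<Prod>i\<in>I. Poly_Mapping.single (f i) (1::'b::comm_semiring_1)) = Poly_Mapping.single (\<Sum>i\<in>I. f i) 1"
  by (induction I rule: infinite_finite_induct) (auto simp: mult_single)

lemma sum_single_keys:
  "(\<Sum>i\<in>Poly_Mapping.keys m. Poly_Mapping.single i (Poly_Mapping.lookup m i)) = m"
proof (rule poly_mapping_eqI)
  fix j
  have "(\<Sum>i\<in>Poly_Mapping.keys m. Poly_Mapping.lookup m i when i = j) = Poly_Mapping.lookup m j"
    by (auto simp: when_def in_keys_iff)
  then show "Poly_Mapping.lookup (\<Sum>i\<in>Poly_Mapping.keys m.
      Poly_Mapping.single i (Poly_Mapping.lookup m i)) j = Poly_Mapping.lookup m j"
    by (simp add: lookup_sum lookup_single)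
qed

text \<open>
  Each variable in \<open>D\<close> contributes a factor \<open>q\<close> per occurrence in \<open>m\<close>, and the variables
  themselves reassemble \<open>m\<close>.
\<close>

lemma prod_scaled_vars:
  "(\<Prod>i\<in>Poly_Mapping.keys m. (if i \<in> D then Const q * Var i else Var i) ^ Poly_Mapping.lookup m i)
    = Poly_Mapping.single m (q ^ degree_in D m)"
proof -
  let ?e = "Poly_Mapping.lookup m" and ?K = "Poly_Mapping.keys m"
  have "(\<Prod>i\<in>?K. (if i \<in> D then Const q * Var i else Var i) ^ ?e i)
      = (\<Prod>i\<in>?K. Const (q ^ (if i \<in> D then ?e i else 0)) * Poly_Mapping.single (Poly_Mapping.single i (?e i)) 1)"
    by (rule prod.cong) (auto simp: power_mult_distrib Const_power Const_one Var_power)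
  also have "\<dots> = Const (\<Prod>i\<in>?K. q ^ (if i \<in> D then ?e i else 0)) * Poly_Mapping.single m 1"
    by (simp add: prod.distrib Const_prod prod_single_one sum_single_keys)
  also have "(\<Prod>i\<in>?K. q ^ (if i \<in> D then ?e i else 0)) = q ^ degree_in D m"
    by (simp add: power_sum[symmetric] degree_in_def sum.inter_restrict)
  finally show ?thesis
    by (simp add: Const_def mult_single)
qed

text \<open>
  Each monomial goes to a multiple of itself, so coefficients are rescaled without mixing.
\<close>

lemma lookup_scale_vars:
  "Poly_Mapping.lookup (scale_vars D p) m = q ^ degree_in D m * Poly_Mapping.lookup p m"
proof -
  have "Poly_Mapping.lookup (scale_vars D p) m
      = (\<Sum>l\<in>Poly_Mapping.keys p. Poly_Mapping.lookup p l * q ^ degree_in D l when l = m)"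
    unfolding scale_vars_def subst_vars_def prod_scaled_vars lookup_sum
    by (simp add: lookup_single mult_when)
  also have "\<dots> = q ^ degree_in D m * Poly_Mapping.lookup p m"
    by (auto simp: when_def in_keys_iff)
  finally show ?thesis .
qed

section \<open>The recursion on coefficients\<close>

definition window :: "int \<Rightarrow> nat \<Rightarrow> int set" where
  "window k w = {k - int j | j. 1 \<le> j \<and> j \<le> w}"

lemma window_eq: "window k w = {k - int w..<k}"
proof (intro equalityI subsetI)
  fix x assume "x \<in> {k - int w..<k}"
  then show "x \<in> window k w"
    unfolding window_def by (intro CollectI exI[of _ "nat (k - x)"]) auto
qed (auto simp: window_def)

lemma sched_poly_snoc:
  "sched_poly (W @ [w]) = Const (1 / (1 - q)) *
    ((Var (int (size_k W)) - Const (q ^ w)) * sched_poly W +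
     (1 - Var (int (size_k W))) * scale_vars (window (int (size_k W)) w) (sched_poly W))"
  by (simp add: Let_def scale_vars_def window_def algebra_simps)

lemma q_neq_1: "q \<noteq> 1"
  by (simp add: q_def One_fract_def eq_fract one_pCons)

lemma qint_eq: "qint n = (1 - q ^ n) / (1 - q)"
  using q_neq_1 by (simp add: qint_def one_diff_power_eq)

text \<open>
  This makes \<open>x\<^sub>k\<close> new in the recursion step: no monomial of the old polynomial contains it, so
  the coefficient of \<open>m x\<^sub>k\<close> in the new polynomial comes from the products with \<open>x\<^sub>k\<close> alone.
\<close>

lemma sched_poly_vars:
  assumes "Poly_Mapping.lookup (sched_poly W) m \<noteq> 0" and "Poly_Mapping.lookup m j \<noteq> 0"
  shows "j \<in> alphabet W"
  using assms
proof (induction W arbitrary: m rule: rev_induct)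
  case Nil
  then show ?case
    by (auto simp: alphabet_def size_k_def Var_def lookup_add lookup_single when_def split: if_splits)
next
  case (snoc w W)
  let ?k = "int (size_k W)" and ?P = "sched_poly W"
  show ?case
  proof (rule ccontr)
    assume j: "j \<notin> alphabet (W @ [w])"
    then have jk: "j \<noteq> ?k" and jW: "j \<notin> alphabet W"
      by (auto simp: alphabet_def size_k_def)
    have P0: "Poly_Mapping.lookup ?P l = 0" if "Poly_Mapping.lookup l j \<noteq> 0" for l
      using snoc.IH[of l] that jW by blast
    have V0: "Poly_Mapping.lookup (Var ?k * p) m = 0"
      if p: "\<And>l. Poly_Mapping.lookup l j \<noteq> 0 \<Longrightarrow> Poly_Mapping.lookup p l = 0" for p :: xpoly
    proof (cases "\<exists>l. m = Poly_Mapping.single ?k 1 + l")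
      case True
      then obtain l where l: "m = Poly_Mapping.single ?k 1 + l" by blast
      then have "Poly_Mapping.lookup l j \<noteq> 0"
        using snoc.prems(2) jk by (simp add: lookup_add lookup_single)
      then show ?thesis by (simp add: l p del: One_nat_def)
    next
      case False
      then show ?thesis by (simp add: Var_def lookup_single_mult_eq_0)
    qed
    have "Poly_Mapping.lookup (sched_poly (W @ [w])) m = 0"
      using snoc.prems(2)
      by (simp add: sched_poly_snoc left_diff_distrib lookup_add lookup_minus lookup_scale_vars
          P0 V0 del: sched_poly.simps)
    with snoc.prems(1) show False by simp
  qed
qed

text \<open>
  With \<open>c\<close> the old coefficient of \<open>m\<close>, the terms with \<open>x\<^sub>k\<close> are \<open>c x\<^sub>k\<close> and \<open>- q\<^sup>d c x\<^sub>k\<close>, over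
  the common denominator \<open>1 - q\<close>.
\<close>

lemma lookup_sched_poly_snoc_up:
  fixes W w
  defines "k \<equiv> int (size_k W)"
  assumes "Poly_Mapping.lookup m k = 0"
  shows "Poly_Mapping.lookup (sched_poly (W @ [w])) (Poly_Mapping.single k 1 + m)
    = qint (degree_in (window k w) m) * Poly_Mapping.lookup (sched_poly W) m"
proof -
  let ?P = "sched_poly W"
  have "Poly_Mapping.lookup ?P (Poly_Mapping.single k 1 + m) = 0"
  proof (rule ccontr)
    assume "Poly_Mapping.lookup ?P (Poly_Mapping.single k 1 + m) \<noteq> 0"
    from sched_poly_vars[OF this, of k] have "k \<in> alphabet W"
      by (simp add: lookup_add)
    then show False by (simp add: alphabet_def k_def)
  qed
  then show ?thesis
    unfolding sched_poly_snoc k_def[symmetric]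
    by (simp add: left_diff_distrib lookup_add lookup_minus lookup_scale_vars qint_eq
        diff_divide_distrib del: One_nat_def)
qed

text \<open>
  The terms without \<open>x\<^sub>k\<close> are \<open>- q\<^sup>w c\<close> and \<open>q\<^sup>d c\<close>.  The hypothesis \<open>d \<le> w\<close> lets \<open>q\<^sup>d\<close> be
  factored out of their sum; it holds for square-free monomials because the window has \<open>w\<close>
  elements.
\<close>

lemma lookup_sched_poly_snoc_down:
  fixes W w
  defines "k \<equiv> int (size_k W)"
  assumes m: "Poly_Mapping.lookup m k = 0" and le: "degree_in (window k w) m \<le> w"
  shows "Poly_Mapping.lookup (sched_poly (W @ [w])) m
    = q ^ degree_in (window k w) m * qint (w - degree_in (window k w) m)
      * Poly_Mapping.lookup (sched_poly W) m"
proof -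
  let ?d = "degree_in (window k w) m"
  have "q ^ ?d * q ^ (w - ?d) = q ^ w"
    using le by (simp add: power_add[symmetric])
  then have "q ^ ?d * qint (w - ?d) = (q ^ ?d - q ^ w) / (1 - q)"
    by (simp add: qint_eq right_diff_distrib)
  then show ?thesis
    unfolding sched_poly_snoc k_def[symmetric]
    by (simp add: left_diff_distrib lookup_add lookup_minus lookup_scale_vars
        lookup_Var_mult_eq_0[OF m] diff_divide_distrib)
qed

section \<open>Square-free monomials\<close>

lemma lookup_sqfree_monom:
  "finite S \<Longrightarrow> Poly_Mapping.lookup (sqfree_monom S) i = (if i \<in> S then 1 else 0)"
  by (simp add: sqfree_monom_def lookup_sum lookup_single when_def)

lemma sqfree_monom_insert:
  "finite S \<Longrightarrow> k \<notin> S \<Longrightarrow> sqfree_monom (insert k S) = Poly_Mapping.single k 1 + sqfree_monom S"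
  by (simp add: sqfree_monom_def)

lemma degree_in_sqfree_monom: "finite S \<Longrightarrow> degree_in D (sqfree_monom S) = card (D \<inter> S)"
proof -
  assume fin: "finite S"
  then have "Poly_Mapping.keys (sqfree_monom S) = S"
    by (auto simp: in_keys_iff lookup_sqfree_monom split: if_splits)
  with fin show ?thesis
    by (simp add: degree_in_def lookup_sqfree_monom Int_commute)
qed

lemma card_window_Int_le: "card (window k w \<inter> S) \<le> w"
proof -
  have "card (window k w \<inter> S) \<le> card (window k w)"
    by (intro card_mono) (auto simp: window_eq)
  then show ?thesis by (simp add: window_eq)
qed

definition bar_factor :: "nat list \<Rightarrow> int set \<Rightarrow> nat \<Rightarrow> qrat" where
  "bar_factor W S i = (let a = card (window (int i) (entry W i) \<inter> S)
     in if int i \<in> S then qint a else q ^ a * qint (entry W i - a))"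

text \<open>
  The induction step below removes the last entry of \<open>W\<close> and the new index from \<open>S\<close>.  Each
  earlier window lies strictly below its own bar, so its factor is unchanged.
\<close>

lemma bar_factor_snoc:
  assumes "1 \<le> i" and "i \<le> length W"
  shows "bar_factor (W @ [w]) S i = bar_factor W (S - {int (size_k W)}) i"
proof -
  have "entry (W @ [w]) i = entry W i"
    using assms by (auto simp: entry_def nth_append)
  moreover have "window (int i) v \<inter> S = window (int i) v \<inter> (S - {int (size_k W)})" for v
    using assms by (auto simp: window_eq size_k_def)
  ultimately show ?thesis
    using assms by (simp add: bar_factor_def size_k_def Let_def)
qed

lemma lookup_sched_poly_sqfree_monom:
  assumes "S \<subseteq> alphabet W" and "(-1 \<in> S) \<noteq> (0 \<in> S)"
  shows "Poly_Mapping.lookup (sched_poly W) (sqfree_monom S)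
    = q ^ (if -1 \<in> S then 1 else 0) * (\<Prod>i\<in>{1..length W}. bar_factor W S i)"
  using assms
proof (induction W arbitrary: S rule: rev_induct)
  case Nil
  then have "S \<subseteq> {-1, 0}"
    by (auto simp: alphabet_def size_k_def)
  with Nil.prems(2) have "S = {-1} \<or> S = {0}"
    by auto
  moreover have "Poly_Mapping.single (-1) (1::nat) \<noteq> Poly_Mapping.single (0::int) 1"
  proof
    assume "Poly_Mapping.single (-1) (1::nat) = Poly_Mapping.single (0::int) 1"
    then have "Poly_Mapping.lookup (Poly_Mapping.single (-1::int) (1::nat)) 0
        = Poly_Mapping.lookup (Poly_Mapping.single (0::int) 1) 0"
      by (rule arg_cong)
    then show False by (simp add: lookup_single)
  qed
  ultimately show ?case
    by (auto simp: sqfree_monom_def Var_def lookup_add lookup_single_not_eq)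
next
  case (snoc w W)
  define k where "k = int (size_k W)"
  define T where "T = S - {k}"
  have T: "T \<subseteq> alphabet W"
    using snoc.prems(1) by (auto simp: T_def k_def alphabet_def size_k_def)
  have fin: "finite T"
    using T by (rule finite_subset) (simp add: alphabet_def)
  have km: "Poly_Mapping.lookup (sqfree_monom T) k = 0"
    using fin by (simp add: lookup_sqfree_monom T_def)
  have low: "-1 \<in> S \<longleftrightarrow> -1 \<in> T" "0 \<in> S \<longleftrightarrow> 0 \<in> T"
    by (auto simp: T_def k_def size_k_def)
  have win: "window k w \<inter> S = window k w \<inter> T"
    by (auto simp: T_def window_eq)
  have k: "k = int (Suc (length W))"
    by (simp add: k_def size_k_def)
  have factor: "bar_factor (W @ [w]) S (Suc (length W)) =
      (let a = card (window k w \<inter> T) in if k \<in> S then qint a else q ^ a * qint (w - a))"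
    using win by (simp add: bar_factor_def entry_def k Let_def)
  have step: "Poly_Mapping.lookup (sched_poly (W @ [w])) (sqfree_monom S)
      = bar_factor (W @ [w]) S (Suc (length W)) * Poly_Mapping.lookup (sched_poly W) (sqfree_monom T)"
  proof (cases "k \<in> S")
    case True
    then have "sqfree_monom S = Poly_Mapping.single k 1 + sqfree_monom T"
      using sqfree_monom_insert[OF fin, of k] by (simp add: T_def insert_absorb)
    then show ?thesis
      using lookup_sched_poly_snoc_up[of "sqfree_monom T" W w] km True fin
      by (simp add: factor degree_in_sqfree_monom k_def[symmetric] del: sched_poly.simps)
  next
    case False
    then have "sqfree_monom S = sqfree_monom T" by (simp add: T_def)
    then show ?thesis
      using lookup_sched_poly_snoc_down[of "sqfree_monom T" W w] km False fin
      by (simp add: factor degree_in_sqfree_monom card_window_Int_le k_def[symmetric]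
          Let_def del: sched_poly.simps)
  qed
  have "(\<Prod>i\<in>{1..length W}. bar_factor (W @ [w]) S i) = (\<Prod>i\<in>{1..length W}. bar_factor W T i)"
    by (rule prod.cong) (auto simp: bar_factor_snoc T_def k_def)
  with step show ?case
    using snoc.IH[OF T] snoc.prems(2) by (simp add: low del: sched_poly.simps)
qed

theorem theorem1p2:
  fixes W :: "nat list" and BD :: "int \<Rightarrow> bar_state" and S :: "int set"
    and k :: nat and a :: "nat \<Rightarrow> nat"
  assumes "legal_schedule W"
    and "bar_diagram W BD"
    and "k = size_k W"
    and "S = up_set W BD"
    and "\<And>i. 1 \<le> i \<Longrightarrow> i \<le> k - 1 \<Longrightarrow> a i = card ({int i - int j | j. 1 \<le> j \<and> j \<le> entry W i} \<inter> S)"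
  shows "Poly_Mapping.lookup (sched_poly W) (sqfree_monom S) =
    q ^ (if -1 \<in> S then 1 else 0) *
    (\<Prod>i\<in>{i \<in> {1..k - 1}. int i \<in> S}. qint (a i)) *
    (\<Prod>i\<in>{i \<in> {1..k - 1}. int i \<notin> S}. q ^ a i * qint (entry W i - a i))"
proof -
  let ?I = "{1..k - 1}"
  let ?up = "\<lambda>i. qint (a i)" and ?down = "\<lambda>i. q ^ a i * qint (entry W i - a i)"
  have "S \<subseteq> alphabet W" "(-1 \<in> S) \<noteq> (0 \<in> S)"
    using assms(2,4) by (auto simp: up_set_def bar_diagram_def alphabet_def size_k_def)
  then have "Poly_Mapping.lookup (sched_poly W) (sqfree_monom S)
      = q ^ (if -1 \<in> S then 1 else 0) * (\<Prod>i\<in>{1..length W}. bar_factor W S i)"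
    by (rule lookup_sched_poly_sqfree_monom)
  also have "(\<Prod>i\<in>{1..length W}. bar_factor W S i) = (\<Prod>i\<in>?I. if int i \<in> S then ?up i else ?down i)"
    using assms(3,5) by (intro prod.cong) (auto simp: bar_factor_def window_def Let_def size_k_def)
  also have "\<dots> = (\<Prod>i\<in>{i \<in> ?I. int i \<in> S}. ?up i) * (\<Prod>i\<in>{i \<in> ?I. int i \<notin> S}. ?down i)"
    by (simp add: prod.If_cases Int_def)
  finally show ?thesis
    by (simp only: mult.assoc)
qed

end
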